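(* Let $L>0$. There exist a nonadaptive horizon-independent linear-span method $\mathcal A$ and an output selector function $p:\mathbb N\to\mathbb N_0$, with $p(N)\le N$ for every $N$, such that $$\mathcal G_N^{\mathrm{best}}(\mathcal A)\le\mathcal G_{p(N)}(\mathcal A)\le\frac{64}{(N+1)^2}\qquad\text{for every }N\ge1.$$
   Context: Fix $L>0$; $\mathbb N=\{1,2,\ldots\}$, $\mathbb N_0=\{0,1,2,\ldots\}$. $\mathcal F_{0,L}(\mathbb R^d)$ is the class of convex differentiable functions $f:\mathbb R^d\to\mathbb R$ that admit a minimizer and whose gradient is $L$-Lipschitz (Euclidean norm); $f_\star:=\min f$. A nonadaptive horizon-independent linear-span method $\mathcal A$ is given by a single infinite array of real coefficients $(\beta_{i,k})_{0\le i<k}$, fixed in advance (independent of $f$, of $x_0$, of the dimension, of all observed gradients, and of any stopping horizon). Applied to $f$ and $x_0$ it generates $x_k=x_0-\frac1L\sum_{i=0}^{k-1}\beta_{i,k}\nabla f(x_i)$, $k\ge1$. For $n\ge0$, $$\mathcal G_n(\mathcal A):=\sup_{d\ge1,\ f\in\mathcal F_{0,L}(\mathbb R^d),\ x_0\in\mathbb R^d,\ f(x_0)>f_\star}\frac{\|\nabla f(x_n)\|^2}{L(f(x_0)-f_\star)},$$ and $\mathcal G_N^{\mathrm{best}}(\mathcal A)$ is obtained from $\mathcal G_N(\mathcal A)$ by replacing $\|\nabla f(x_N)\|^2$ with $\min_{0\le k\le N}\|\nabla f(x_k)\|^2$. The selector $p$ is a fixed function of $N$ only, not of observed gradients. *)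

theory Defs
  imports "HOL-Analysis.Analysis"
begin

text \<open>
  The supremum over all dimensions stands below an existential quantifier, so the dimension cannot
  be a type. All spaces \<open>\<real>\<^sup>d\<close> are therefore realised inside one real inner product space,
  the finitely supported real sequences, as the subspaces \<open>Rd d\<close> of the sequences that vanish
  from index \<open>d\<close> on. On each of them inner product and norm are the Euclidean ones
  (\<open>inner_Rd\<close>, \<open>norm_Rd\<close>).
\<close>

typedef finseq = "{x :: nat \<Rightarrow> real. finite {i. x i \<noteq> 0}}"
  morphisms coord Abs_finseq
  by (rule exI[of _ "\<lambda>_. 0"]) simp

setup_lifting type_definition_finseq

lemma finseq_eqI: "(\<And>i. coord x i = coord y i) \<Longrightarrow> x = y"
  by (simp add: coord_inject[symmetric] ext)

lemma finite_coord: "finite {i. coord x i \<noteq> 0}"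
  using coord[of x] by simp

instantiation finseq :: real_inner
begin

lift_definition zero_finseq :: finseq is "\<lambda>_. 0" by simp

lift_definition plus_finseq :: "finseq \<Rightarrow> finseq \<Rightarrow> finseq" is "\<lambda>x y i. x i + y i"
  subgoal for x y
    by (rule finite_subset[of _ "{i. x i \<noteq> 0} \<union> {i. y i \<noteq> 0}"]) auto
  done

lift_definition minus_finseq :: "finseq \<Rightarrow> finseq \<Rightarrow> finseq" is "\<lambda>x y i. x i - y i"
  subgoal for x y
    by (rule finite_subset[of _ "{i. x i \<noteq> 0} \<union> {i. y i \<noteq> 0}"]) auto
  done

lift_definition uminus_finseq :: "finseq \<Rightarrow> finseq" is "\<lambda>x i. - x i"
  by simp

lift_definition scaleR_finseq :: "real \<Rightarrow> finseq \<Rightarrow> finseq" is "\<lambda>r x i. r * x i"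
  by (erule finite_subset[rotated]) auto

definition inner_finseq :: "finseq \<Rightarrow> finseq \<Rightarrow> real" where
  "inner_finseq x y = (\<Sum>i | coord x i \<noteq> 0. coord x i * coord y i)"

definition norm_finseq :: "finseq \<Rightarrow> real" where
  "norm_finseq x = sqrt (inner x x)"

definition sgn_finseq :: "finseq \<Rightarrow> finseq" where
  "sgn_finseq x = inverse (norm x) *\<^sub>R x"

definition dist_finseq :: "finseq \<Rightarrow> finseq \<Rightarrow> real" where
  "dist_finseq x y = norm (x - y)"

definition uniformity_finseq :: "(finseq \<times> finseq) filter" where
  "uniformity_finseq = (INF e\<in>{0<..}. principal {(x, y). dist x y < e})"

definition open_finseq :: "finseq set \<Rightarrow> bool" where
  "open_finseq U \<longleftrightarrow> (\<forall>x\<in>U. \<forall>\<^sub>F (x', y) in uniformity. x' = x \<longrightarrow> y \<in> U)"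

lemma inner_finseq_superset:
  assumes "finite K" "{i. coord x i \<noteq> 0} \<subseteq> K"
  shows "inner x y = (\<Sum>i\<in>K. coord x i * coord y i)"
  unfolding inner_finseq_def by (rule sum.mono_neutral_left) (use assms in auto)

instance
proof
  fix x y z :: finseq and r :: real
  let ?S = "\<lambda>x. {i. coord x i \<noteq> 0}"
  let ?K = "?S x \<union> ?S y"
  have K: "finite ?K" by (simp add: finite_coord)
  show "x + y + z = x + (y + z)" "x + y = y + x" "0 + x = x" "- x + x = 0" "x - y = x + - y"
    by (transfer; simp add: algebra_simps fun_eq_iff)+
  show "r *\<^sub>R (x + y) = r *\<^sub>R x + r *\<^sub>R y" by transfer (simp add: algebra_simps)
  show "(r + s) *\<^sub>R x = r *\<^sub>R x + s *\<^sub>R x" for s by transfer (simp add: algebra_simps)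
  show "r *\<^sub>R s *\<^sub>R x = (r * s) *\<^sub>R x" for s by transfer (simp add: algebra_simps)
  show "1 *\<^sub>R x = x" by transfer simp
  show "dist x y = norm (x - y)" by (rule dist_finseq_def)
  show "sgn x = inverse (norm x) *\<^sub>R x" by (rule sgn_finseq_def)
  show "uniformity = (INF e\<in>{0<..}. principal {(x, y :: finseq). dist x y < e})"
    by (rule uniformity_finseq_def)
  show "open U \<longleftrightarrow> (\<forall>x\<in>U. \<forall>\<^sub>F (x', y) in uniformity. x' = x \<longrightarrow> y \<in> U)" for U :: "finseq set"
    by (rule open_finseq_def)
  show "norm x = sqrt (inner x x)" by (rule norm_finseq_def)
  show "inner x y = inner y x"
    using inner_finseq_superset[of ?K x y] inner_finseq_superset[of ?K y x] K
    by (simp add: mult.commute)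
  have "?S (x + y) \<subseteq> ?K" by (auto simp: plus_finseq.rep_eq)
  then show "inner (x + y) z = inner x z + inner y z"
    using inner_finseq_superset[of ?K _ z] K
    by (simp add: plus_finseq.rep_eq algebra_simps sum.distrib)
  have "?S (r *\<^sub>R x) \<subseteq> ?K" by (auto simp: scaleR_finseq.rep_eq)
  then show "inner (r *\<^sub>R x) y = r * inner x y"
    using inner_finseq_superset[of ?K _ y] K
    by (simp add: scaleR_finseq.rep_eq algebra_simps sum_distrib_left)
  show "0 \<le> inner x x" by (simp add: inner_finseq_def sum_nonneg)
  show "inner x x = 0 \<longleftrightarrow> x = 0"
  proof
    assume "inner x x = 0"
    then have "\<forall>i\<in>?S x. coord x i * coord x i = 0"
      by (simp add: inner_finseq_def sum_nonneg_eq_0_iff finite_coord)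
    then show "x = 0" by (intro finseq_eqI) (auto simp: zero_finseq.rep_eq)
  qed (simp add: inner_finseq_def zero_finseq.rep_eq)
qed

end

definition Rd :: "nat \<Rightarrow> finseq set" where
  "Rd d = {x. \<forall>i\<ge>d. coord x i = 0}"

lemma coord_sum: "coord (\<Sum>i\<in>A. f i) j = (\<Sum>i\<in>A. coord (f i) j)"
  by (induction A rule: infinite_finite_induct) (simp_all add: zero_finseq.rep_eq plus_finseq.rep_eq)

lemma subspace_Rd: "subspace (Rd d)"
  by (auto simp: subspace_def Rd_def zero_finseq.rep_eq plus_finseq.rep_eq scaleR_finseq.rep_eq)

lemma inner_Rd:
  assumes "x \<in> Rd d"
  shows "inner x y = (\<Sum>i<d. coord x i * coord y i)"
proof (rule inner_finseq_superset)
  show "{i. coord x i \<noteq> 0} \<subseteq> {..<d}"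
    using assms unfolding Rd_def by (auto intro: ccontr)
qed simp

lemma norm_Rd:
  assumes "x \<in> Rd d"
  shows "norm x = L2_set (coord x) {..<d}"
proof -
  have "(norm x)\<^sup>2 = (\<Sum>i<d. (coord x i)\<^sup>2)"
    unfolding power2_norm_eq_inner inner_Rd[OF assms] by (simp add: power2_eq_square)
  then show ?thesis unfolding L2_set_def by (metis norm_ge_zero real_sqrt_abs abs_of_nonneg)
qed

lemma coord_Rd_onto: "\<exists>x\<in>Rd d. \<forall>i<d. coord x i = c i"
proof -
  have "finite {i. (if i < d then c i else 0) \<noteq> 0}"
    by (rule finite_subset[of _ "{..<d}"]) auto
  then show ?thesis
    by (intro bexI[of _ "Abs_finseq (\<lambda>i. if i < d then c i else 0)"])
      (auto simp: Rd_def Abs_finseq_inverse)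
qed

text \<open>
  In the following, a function on \<open>\<real>\<^sup>d\<close> is represented by any extension to the ambient space;
  its values outside \<open>Rd d\<close> play no role.
\<close>

definition grad :: "nat \<Rightarrow> (finseq \<Rightarrow> real) \<Rightarrow> finseq \<Rightarrow> finseq" where
  "grad d f x = (THE g. g \<in> Rd d \<and> (f has_derivative (\<lambda>h. inner g h)) (at x within Rd d))"

lemma grad_unique:
  assumes x: "x \<in> Rd d" and g: "g \<in> Rd d" and g': "g' \<in> Rd d"
    and D: "(f has_derivative (\<lambda>h. inner g h)) (at x within Rd d)"
    and D': "(f has_derivative (\<lambda>h. inner g' h)) (at x within Rd d)"
  shows "g = g'"
proof -
  define l where "l t = x + t *\<^sub>R (g - g')" for t :: real
  have l: "l ` UNIV \<subseteq> Rd d"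
    using x g g' by (auto simp: l_def intro!: subspace_add subspace_scale subspace_diff subspace_Rd)
  have dl: "(l has_derivative (\<lambda>t. t *\<^sub>R (g - g'))) (at 0)"
    unfolding l_def by (auto intro!: derivative_eq_intros)
  have "((\<lambda>t. f (l t)) has_derivative (\<lambda>t. inner a (t *\<^sub>R (g - g')))) (at 0)"
    if "(f has_derivative (\<lambda>h. inner a h)) (at x within Rd d)" for a
    by (rule has_derivative_in_compose[OF dl])
      (use has_derivative_subset[OF that l] in \<open>simp add: l_def\<close>)
  from has_derivative_unique[OF this[OF D] this[OF D']]
  have "inner g (g - g') = inner g' (g - g')" by (metis scaleR_one)
  then have "inner (g - g') (g - g') = 0" by (simp add: inner_diff_left)
  then show ?thesis by simp
qed

lemma grad_eqI:
  assumes "x \<in> Rd d" "g \<in> Rd d" "(f has_derivative (\<lambda>h. inner g h)) (at x within Rd d)"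
  shows "grad d f x = g"
  unfolding grad_def
proof (rule the_equality)
  fix g' assume "g' \<in> Rd d \<and> (f has_derivative (\<lambda>h. inner g' h)) (at x within Rd d)"
  then show "g' = g" using grad_unique[OF assms(1) _ assms(2) _ assms(3)] by simp
qed (simp add: assms)

lemma grad_works:
  assumes x: "x \<in> Rd d" and diff: "f differentiable (at x within Rd d)"
  shows "grad d f x \<in> Rd d" "(f has_derivative (\<lambda>h. inner (grad d f x) h)) (at x within Rd d)"
proof -
  obtain D where D: "(f has_derivative D) (at x within Rd d)"
    using diff by (auto simp: differentiable_def)
  interpret D: bounded_linear D using D by (rule has_derivative_bounded_linear)
  have "\<forall>i. \<exists>y\<in>Rd d. \<forall>j<d. coord y j = (if i = j then 1 else 0)"
    by (intro allI coord_Rd_onto)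
  then obtain e where e: "\<And>i. e i \<in> Rd d"
    and ec: "\<And>i j. j < d \<Longrightarrow> coord (e i) j = (if i = j then 1 else 0)"
    by metis
  obtain g where g: "g \<in> Rd d" and gc: "\<And>i. i < d \<Longrightarrow> coord g i = D (e i)"
    using coord_Rd_onto[of d "\<lambda>i. D (e i)"] by auto
  have Dg: "D h = inner g h" if h: "h \<in> Rd d" for h
  proof -
    have "h = (\<Sum>i<d. coord h i *\<^sub>R e i)"
    proof (rule finseq_eqI)
      fix j
      show "coord h j = coord (\<Sum>i<d. coord h i *\<^sub>R e i) j"
      proof (cases "j < d")
        case True
        then have "(\<Sum>i<d. coord h i * coord (e i) j) = (\<Sum>i<d. if i = j then coord h i else 0)"
          by (intro sum.cong) (auto simp: ec)
        then show ?thesis using True by (simp add: coord_sum scaleR_finseq.rep_eq)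
      next
        case False
        then have "coord (e i) j = 0" for i
          using e[of i] by (simp add: Rd_def)
        then show ?thesis using False h by (simp add: coord_sum scaleR_finseq.rep_eq Rd_def)
      qed
    qed
    then have "D h = D (\<Sum>i<d. coord h i *\<^sub>R e i)" by (rule arg_cong)
    also have "\<dots> = (\<Sum>i<d. coord h i * D (e i))" by (simp add: D.sum D.scaleR)
    also have "\<dots> = inner g h"
      using g by (simp add: inner_Rd gc mult.commute)
    finally show ?thesis .
  qed
  have "(f has_derivative (\<lambda>h. inner g h)) (at x within Rd d)"
    unfolding has_derivative_within
  proof
    show "bounded_linear (inner g)" by (rule bounded_linear_inner_right)
    have "((\<lambda>y. (1 / norm (y - x)) *\<^sub>R (f y - (f x + D (y - x)))) \<longlongrightarrow> 0) (at x within Rd d)"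
      using D by (simp add: has_derivative_within)
    then show "((\<lambda>y. (1 / norm (y - x)) *\<^sub>R (f y - (f x + inner g (y - x)))) \<longlongrightarrow> 0) (at x within Rd d)"
    proof (rule Lim_transform_within)
      fix y assume "y \<in> Rd d"
      then have "D (y - x) = inner g (y - x)"
        by (intro Dg subspace_diff[OF subspace_Rd] x)
      then show "(1 / norm (y - x)) *\<^sub>R (f y - (f x + D (y - x))) =
          (1 / norm (y - x)) *\<^sub>R (f y - (f x + inner g (y - x)))"
        by (rule arg_cong)
    qed (rule zero_less_one)
  qed
  moreover from grad_eqI[OF x g this] have "grad d f x = g" .
  ultimately show "grad d f x \<in> Rd d" "(f has_derivative (\<lambda>h. inner (grad d f x) h)) (at x within Rd d)"
    using g by (simp_all only:)
qed

definition smooth_convex :: "real \<Rightarrow> nat \<Rightarrow> (finseq \<Rightarrow> real) \<Rightarrow> bool" where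
  "smooth_convex L d f \<longleftrightarrow>
     convex_on (Rd d) f \<and> f differentiable_on Rd d \<and>
     (\<exists>z\<in>Rd d. \<forall>y\<in>Rd d. f z \<le> f y) \<and>
     L-lipschitz_on (Rd d) (grad d f)"

definition fstar :: "nat \<Rightarrow> (finseq \<Rightarrow> real) \<Rightarrow> real" where
  "fstar d f = (INF y\<in>Rd d. f y)"

lemma fstar_eq_min:
  assumes "z \<in> Rd d" "\<And>y. y \<in> Rd d \<Longrightarrow> f z \<le> f y"
  shows "fstar d f = f z"
  unfolding fstar_def by (rule cInf_eq_minimum) (use assms in auto)

text \<open>
  A method is its coefficient array; only the entries \<open>\<beta> i k\<close> with \<open>i < k\<close> are used.
\<close>

fun iterate :: "real \<Rightarrow> (nat \<Rightarrow> nat \<Rightarrow> real) \<Rightarrow> nat \<Rightarrow> (finseq \<Rightarrow> real) \<Rightarrow> finseq \<Rightarrow> nat \<Rightarrow> finseq"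
  where
    "iterate L \<beta> d f x0 k =
       x0 - (1 / L) *\<^sub>R (\<Sum>i<k. \<beta> i k *\<^sub>R grad d f (iterate L \<beta> d f x0 i))"

declare iterate.simps [simp del]

lemma iterate_0: "iterate L \<beta> d f x0 0 = x0"
  by (subst iterate.simps) simp

definition rate_last :: "real \<Rightarrow> (nat \<Rightarrow> nat \<Rightarrow> real) \<Rightarrow> nat \<Rightarrow> ereal" where
  "rate_last L \<beta> n = Sup
     {ereal ((norm (grad d f (iterate L \<beta> d f x0 n)))\<^sup>2 / (L * (f x0 - fstar d f))) | d f x0.
        d \<ge> 1 \<and> smooth_convex L d f \<and> x0 \<in> Rd d \<and> f x0 > fstar d f}"

definition rate_best :: "real \<Rightarrow> (nat \<Rightarrow> nat \<Rightarrow> real) \<Rightarrow> nat \<Rightarrow> ereal" where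
  "rate_best L \<beta> N = Sup
     {ereal ((MIN k\<in>{..N}. (norm (grad d f (iterate L \<beta> d f x0 k)))\<^sup>2) / (L * (f x0 - fstar d f))) | d f x0.
        d \<ge> 1 \<and> smooth_convex L d f \<and> x0 \<in> Rd d \<and> f x0 > fstar d f}"

end

theory Submission
  imports Defs "HOL-Library.Discrete_Functions"
begin

text \<open>
  For a fixed horizon \<open>n\<close>, the OGM-G method of Kim and Fessler satisfies
  \<open>\<parallel>\<nabla>f(x\<^sub>n)\<parallel>\<^sup>2 \<le> 4 L (f(x\<^sub>0) - f\<^sub>\<star>) / (n + 1)\<^sup>2\<close>. Its coefficients depend on \<open>n\<close>, so the
  horizon-independent method runs OGM-G with the horizons \<open>1, 2, 4, \<dots>\<close> one after the other, each time
  restarting from \<open>x\<^sub>0\<close>; since \<open>\<nabla>f(x\<^sub>0)\<close> is shared, the run with horizon \<open>2\<^sup>J\<close> occupies the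
  indices \<open>2\<^sup>J, \<dots>, 2\<^sup>J\<^sup>+\<^sup>1 - 1\<close>. The selector returns the end of the last completed run, whose horizon
  exceeds \<open>(N + 1) / 4\<close>.

  The fixed-horizon bound is the sum of the cocoercivity inequalities for the pairs \<open>(x\<^sub>k, x\<^sub>k\<^sub>+\<^sub>1)\<close>
  with multipliers \<open>u\<^sub>k\<close>, those for the pairs \<open>(x\<^sub>n, x\<^sub>k)\<close> with multipliers \<open>v\<^sub>k\<close>, and the descent
  inequality at \<open>x\<^sub>n\<close>. For the OGM-G coefficients all mixed inner products cancel and
  \<open>u\<^sub>n\<^sub>-\<^sub>1 \<parallel>\<nabla>f(x\<^sub>n)\<parallel>\<^sup>2\<close> remains.
\<close>

section \<open>Convexity and smoothness inequalities on the subspaces \<open>Rd d\<close>\<close>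

lemma smooth_convex_has_derivative:
  assumes "smooth_convex L d f" "x \<in> Rd d"
  shows "grad d f x \<in> Rd d" "(f has_derivative inner (grad d f x)) (at x within Rd d)"
  using grad_works[of x d f] assms by (auto simp: smooth_convex_def differentiable_on_def)

text \<open>A line with base point and direction in \<open>Rd d\<close> stays in
  \<open>Rd d\<close>, so the derivative within the subspace yields an ordinary one-variable
  derivative.\<close>

lemma smooth_convex_line_derivative:
  assumes f: "smooth_convex L d f" and x: "x \<in> Rd d" and e: "e \<in> Rd d"
  shows "((\<lambda>t. f (x + t *\<^sub>R e)) has_real_derivative inner (grad d f (x + t *\<^sub>R e)) e) (at t)"
proof -
  have line: "x + s *\<^sub>R e \<in> Rd d" for s
    by (intro subspace_add subspace_scale subspace_Rd x e)
  have "((\<lambda>s. x + s *\<^sub>R e) has_derivative (\<lambda>s. s *\<^sub>R e)) (at t)"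
    by (auto intro!: derivative_eq_intros)
  moreover have "(f has_derivative inner (grad d f (x + t *\<^sub>R e))) (at (x + t *\<^sub>R e) within range (\<lambda>s. x + s *\<^sub>R e))"
    by (rule has_derivative_subset[OF smooth_convex_has_derivative(2)[OF f line]]) (use line in auto)
  ultimately have "((\<lambda>s. f (x + s *\<^sub>R e)) has_derivative (\<lambda>s. inner (grad d f (x + t *\<^sub>R e)) (s *\<^sub>R e))) (at t)"
    by (rule has_derivative_in_compose)
  then show ?thesis
    by (simp add: has_field_derivative_def mult.commute[of _ "inner _ _"] )
qed

lemma smooth_convex_above_tangent:
  assumes f: "smooth_convex L d f" and x: "x \<in> Rd d" and y: "y \<in> Rd d"
  shows "f x + inner (grad d f x) (y - x) \<le> f y"
proof -
  let ?\<phi> = "\<lambda>t::real. f (x + t *\<^sub>R (y - x))"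
  have e: "y - x \<in> Rd d" by (intro subspace_diff subspace_Rd x y)
  have line: "x + s *\<^sub>R (y - x) \<in> Rd d" for s
    by (intro subspace_add subspace_scale subspace_Rd x e)
  have "convex_on UNIV ?\<phi>"
  proof (rule convex_onI)
    fix t a b :: real assume t: "0 < t" "t < 1"
    have "x + ((1 - t) *\<^sub>R a + t *\<^sub>R b) *\<^sub>R (y - x) = (1 - t) *\<^sub>R (x + a *\<^sub>R (y - x)) + t *\<^sub>R (x + b *\<^sub>R (y - x))"
      by (simp add: algebra_simps)
    then show "?\<phi> ((1 - t) *\<^sub>R a + t *\<^sub>R b) \<le> (1 - t) * ?\<phi> a + t * ?\<phi> b"
      using convex_onD[of "Rd d" f t] f t line by (simp add: smooth_convex_def)
  qed simp
  from convex_on_imp_above_tangent[OF this, of 0 1] smooth_convex_line_derivative[OF f x e, of 0]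
  have "inner (grad d f x) (y - x) * (1 - 0) \<le> ?\<phi> 1 - ?\<phi> 0" by simp
  then show ?thesis by simp
qed

lemma smooth_convex_below_quadratic:
  assumes f: "smooth_convex L d f" and x: "x \<in> Rd d" and y: "y \<in> Rd d"
  shows "f y \<le> f x + inner (grad d f x) (y - x) + L / 2 * (norm (y - x))\<^sup>2"
proof -
  let ?e = "y - x"
  \<comment> \<open>The gap between \<open>f\<close> and its quadratic upper model along the
    segment; the Lipschitz bound makes its derivative nonpositive on the unit interval.\<close>
  let ?\<psi> = "\<lambda>t::real. f (x + t *\<^sub>R ?e) - t * inner (grad d f x) ?e - L / 2 * (norm ?e)\<^sup>2 * t\<^sup>2"
  have e: "?e \<in> Rd d" by (intro subspace_diff subspace_Rd x y)
  have line: "x + s *\<^sub>R ?e \<in> Rd d" for s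
    by (intro subspace_add subspace_scale subspace_Rd x e)
  have "?\<psi> 1 \<le> ?\<psi> 0"
  proof (rule DERIV_nonpos_imp_nonincreasing[of 0 1 ?\<psi>])
    fix t :: real assume t: "0 \<le> t" "t \<le> 1"
    have "(?\<psi> has_real_derivative inner (grad d f (x + t *\<^sub>R ?e)) ?e - inner (grad d f x) ?e - L * (norm ?e)\<^sup>2 * t) (at t)"
      by (rule derivative_eq_intros smooth_convex_line_derivative[OF f x e] refl | simp)+
    moreover have "inner (grad d f (x + t *\<^sub>R ?e) - grad d f x) ?e \<le> norm (grad d f (x + t *\<^sub>R ?e) - grad d f x) * norm ?e"
      by (rule norm_cauchy_schwarz)
    moreover have "norm (grad d f (x + t *\<^sub>R ?e) - grad d f x) \<le> L * (t * norm ?e)"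
      using lipschitz_onD[of L "Rd d" "grad d f" "x + t *\<^sub>R ?e" x] f line x t
      by (simp add: smooth_convex_def dist_norm)
    then have "norm (grad d f (x + t *\<^sub>R ?e) - grad d f x) * norm ?e \<le> L * (t * norm ?e) * norm ?e"
      by (rule mult_right_mono) simp
    ultimately show "\<exists>D. (?\<psi> has_real_derivative D) (at t) \<and> D \<le> 0"
      by (intro exI conjI) (assumption, simp add: inner_diff_left power2_eq_square algebra_simps)
  qed simp
  then show ?thesis by simp
qed

lemma smooth_convex_gradient_step:
  assumes L: "L > 0" and f: "smooth_convex L d f" and x: "x \<in> Rd d"
  shows "fstar d f + (norm (grad d f x))\<^sup>2 / (2 * L) \<le> f x"
proof -
  let ?g = "grad d f x"
  \<comment> \<open>This point minimizes the quadratic upper model of \<open>f\<close> at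
    \<open>x\<close>.\<close>
  let ?y = "x - (1 / L) *\<^sub>R ?g"
  have y: "?y \<in> Rd d"
    by (intro subspace_diff subspace_scale subspace_Rd x smooth_convex_has_derivative(1)[OF f x])
  obtain z where "z \<in> Rd d" "\<And>y. y \<in> Rd d \<Longrightarrow> f z \<le> f y"
    using f by (auto simp: smooth_convex_def)
  then have "fstar d f \<le> f ?y" using fstar_eq_min[of z d f] y by simp
  also have "\<dots> \<le> f x - inner ?g ?g / L + L / 2 * (norm (?y - x))\<^sup>2"
    using smooth_convex_below_quadratic[OF f x y] by simp
  also have "\<dots> = f x - (norm ?g)\<^sup>2 / (2 * L)"
    using L by (simp add: power_divide flip: power2_norm_eq_inner) (simp add: power2_eq_square field_simps)
  finally show ?thesis by simp
qed

text \<open>Two bounds on \<open>f\<close> at one point are compared: the tangent at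
  \<open>y\<close> from below, the quadratic model at \<open>x\<close> from above. The point
  minimizes the difference of the upper and the lower bound.\<close>

lemma smooth_convex_cocoercive:
  assumes L: "L > 0" and f: "smooth_convex L d f" and x: "x \<in> Rd d" and y: "y \<in> Rd d"
  shows "f y + inner (grad d f y) (x - y) + (norm (grad d f x - grad d f y))\<^sup>2 / (2 * L) \<le> f x"
proof -
  let ?g = "grad d f x" and ?g' = "grad d f y"
  let ?e = "?g - ?g'"
  let ?z = "x - (1 / L) *\<^sub>R ?e"
  have z: "?z \<in> Rd d"
    by (intro subspace_diff subspace_scale subspace_Rd x smooth_convex_has_derivative(1)[OF f x]
        smooth_convex_has_derivative(1)[OF f y])
  have "f y + inner ?g' (x - y) - inner ?g' ?e / L \<le> f ?z"
    using smooth_convex_above_tangent[OF f y z] by (simp add: inner_diff diff_divide_distrib)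
  moreover have "f ?z \<le> f x - inner ?g ?e / L + (norm ?e)\<^sup>2 / (2 * L)"
  proof -
    have "?z - x = - (1 / L) *\<^sub>R ?e" by simp
    then have "inner ?g (?z - x) = - (inner ?g ?e / L)" "(norm (?z - x))\<^sup>2 = (norm ?e)\<^sup>2 / L\<^sup>2"
      by (simp_all only: inner_scaleR_right norm_scaleR power_mult_distrib) (auto simp: power_divide)
    moreover have "L / 2 * ((norm ?e)\<^sup>2 / L\<^sup>2) = (norm ?e)\<^sup>2 / (2 * L)"
      using L by (simp add: power2_eq_square field_simps)
    ultimately show ?thesis using smooth_convex_below_quadratic[OF f x z] by simp
  qed
  moreover have "inner ?g ?e / L - inner ?g' ?e / L = 2 * ((norm ?e)\<^sup>2 / (2 * L))"
    by (simp add: power2_norm_eq_inner inner_diff_left diff_divide_distrib)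
  ultimately show ?thesis by linarith
qed

section \<open>The weighted sum of inequalities for a fixed horizon\<close>

text \<open>
  Here \<open>G = \<nabla>f / L\<close> and \<open>F = f / L\<close>, so that \<open>L\<close> disappears. The hypothesis on \<open>x\<close> expresses \<open>x\<^sub>k\<close>
  through two weighted sums of gradients that do not depend on \<open>k\<close> otherwise, which lets the weighted
  sum of the inequalities telescope.
\<close>

lemma gradient_certificate:
  fixes x G :: "nat \<Rightarrow> 'a::real_inner" and F u v h a :: "nat \<Rightarrow> real"
  assumes coco: "\<And>i j. i \<le> Suc M \<Longrightarrow> j \<le> Suc M \<Longrightarrow>
      F j + inner (G j) (x i - x j) + (norm (G i - G j))\<^sup>2 / 2 \<le> F i"
    and descent: "Fs + (norm (G (Suc M)))\<^sup>2 / 2 \<le> F (Suc M)"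
    and x: "\<And>k. k \<le> Suc M \<Longrightarrow> x k = x 0 - (\<Sum>j<k. (h j - a k * v j) *\<^sub>R G j)"
    and u: "\<And>k. k \<le> M \<Longrightarrow> 0 \<le> u k" and v: "\<And>k. k \<le> M \<Longrightarrow> 0 \<le> v k"
    and v0: "v 0 = u 0 - 1" and vS: "\<And>k. k < M \<Longrightarrow> v (Suc k) = u (Suc k) - u k"
    and h0: "h 0 * v 0 = u 0 - 1/2" and hS: "\<And>k. k < M \<Longrightarrow> h (Suc k) * v (Suc k) = u (Suc k)"
    and va: "\<And>k. k \<le> M \<Longrightarrow> v k * a k = h k - 1"
    and ua: "\<And>k. k < M \<Longrightarrow> u k * (a k - a (Suc k)) = 2 * h (Suc k) - 1"
    and a_last: "u M * a M = 1" "a (Suc M) = 0"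
  shows "u M * (norm (G (Suc M)))\<^sup>2 \<le> F 0 - Fs"
proof -
  define w where "w k = (\<Sum>j<k. v j *\<^sub>R G j)" for k
  define H where "H k = (\<Sum>j<k. h j *\<^sub>R G j)" for k
  \<comment> \<open>The gradient part of the inequality for \<open>(i, Suc i)\<close> times
    \<open>u i\<close>, plus the part of the one for \<open>(Suc M, i)\<close> times
    \<open>v i\<close> that is free of the last point and its gradient.\<close>
  define q where "q i = u i * (inner (G (Suc i)) (x i - x (Suc i)) + (norm (G i - G (Suc i)))\<^sup>2 / 2)
      + v i * (inner (G i) (G i) / 2 - inner (G i) (x i))" for i
  define N where "N = Suc M"
  have xk: "x k = x 0 - H k + a k *\<^sub>R w k" if "k \<le> Suc M" for k
    using x[OF that]
    by (simp add: H_def w_def scaleR_diff_left sum_subtractf scaleR_sum_right)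
  have wS: "w (Suc k) = w k + v k *\<^sub>R G k" and HS: "H (Suc k) = H k + h k *\<^sub>R G k" for k
    by (simp_all add: w_def H_def)
  \<comment> \<open>Adding the increment of \<open>inner (w k) (x 0 - H k)\<close> removes every
    term that contains \<open>x 0\<close>.\<close>
  have step: "q k + inner (w (Suc k)) (x 0 - H (Suc k)) - inner (w k) (x 0 - H k) =
      u k * (a k - a (Suc k)) * inner (G (Suc k)) (w (Suc k)) + u k / 2 * inner (G (Suc k)) (G (Suc k))
      + (u k / 2 + v k / 2 - h k * v k) * inner (G k) (G k) - (2 * h k - 1) * inner (G k) (w k)"
    if k: "k \<le> M" for k
  proof -
    \<comment> \<open>By \<open>va\<close> the coefficient of \<open>G k\<close> is exactly 1, so
      its product with \<open>G (Suc k)\<close> cancels the mixed term of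
      \<open>norm (G k - G (Suc k))\<close> squared.\<close>
    have d: "x k - x (Suc k) = G k + (a k - a (Suc k)) *\<^sub>R w (Suc k)"
    proof -
      have "h k = v k * a k + 1" using va[OF k] by simp
      then show ?thesis
        unfolding xk[OF le_SucI[OF k]] xk[OF Suc_le_mono[THEN iffD2, OF k]]
        by (simp add: HS wS algebra_simps)
    qed
    have i: "inner (G k) (x k) = inner (G k) (x 0 - H k) + a k * inner (G k) (w k)"
      using xk[of k] k by (simp add: inner_add_right)
    have n: "(norm (G k - G (Suc k)))\<^sup>2 = inner (G k) (G k) - 2 * inner (G (Suc k)) (G k) + inner (G (Suc k)) (G (Suc k))"
      by (simp add: power2_norm_eq_inner inner_diff inner_commute)
    have "q k = u k * (inner (G (Suc k)) (G k) + (a k - a (Suc k)) * inner (G (Suc k)) (w (Suc k))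
        + (inner (G k) (G k) - 2 * inner (G (Suc k)) (G k) + inner (G (Suc k)) (G (Suc k))) / 2)
      + v k * (inner (G k) (G k) / 2) - v k * inner (G k) (x 0 - H k) - (h k - 1) * inner (G k) (w k)"
      unfolding q_def d i n va[OF k, symmetric] by (simp add: inner_add_right algebra_simps)
    moreover have "inner (w (Suc k)) (x 0 - H (Suc k)) - inner (w k) (x 0 - H k)
        = v k * inner (G k) (x 0 - H k) - h k * inner (G k) (w k) - h k * v k * inner (G k) (G k)"
      unfolding wS HS by (simp add: inner_simps inner_commute algebra_simps)
    ultimately show ?thesis by (simp add: field_simps)
  qed
  \<comment> \<open>Each step leaves one multiple of \<open>inner (G (Suc k)) (w (Suc k))\<close>
    and one of the squared norm of \<open>G (Suc k)\<close>. The next step cancels the first by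
    \<open>ua\<close> and the second by \<open>hS\<close> and \<open>vS\<close>; \<open>h0\<close>
    and \<open>v0\<close> clear the start.\<close>
  have Q: "(\<Sum>i<Suc k. q i) = - inner (w (Suc k)) (x 0 - H (Suc k))
      + u k * (a k - a (Suc k)) * inner (G (Suc k)) (w (Suc k)) + u k / 2 * inner (G (Suc k)) (G (Suc k))"
    if "k \<le> M" for k using that
  proof (induction k)
    case 0
    have "u 0 / 2 + v 0 / 2 - h 0 * v 0 = 0" using h0 v0 by linarith
    moreover have "w 0 = 0" by (simp add: w_def)
    ultimately show ?case using step[of 0] by simp
  next
    case (Suc k)
    have c: "u (Suc k) / 2 + v (Suc k) / 2 - h (Suc k) * v (Suc k) = - u k / 2"
      using hS[of k] vS[of k] Suc.prems by linarith
    have b: "2 * h (Suc k) - 1 = u k * (a k - a (Suc k))"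
      using ua[of k] Suc.prems by simp
    have "(\<Sum>i<Suc k. q i) = - inner (w (Suc k)) (x 0 - H (Suc k))
      + u k * (a k - a (Suc k)) * inner (G (Suc k)) (w (Suc k)) + u k / 2 * inner (G (Suc k)) (G (Suc k))"
      using Suc by simp
    with step[OF Suc.prems, unfolded c b] show ?case
      unfolding sum.lessThan_Suc[of q "Suc k"] by linarith
  qed
  have V: "(\<Sum>i<Suc k. v i) = u k - 1" if "k \<le> M" for k using that
    by (induction k) (auto simp: v0 vS)
  have FF: "(\<Sum>i<Suc k. u i * (F i - F (Suc i)) + v i * (F N - F i)) = F 0 - u k * F (Suc k) + (u k - 1) * F N"
    if "k \<le> M" for k using that
    by (induction k) (auto simp: v0 vS algebra_simps)
  have "q i + v i * (inner (G i) (x N - G N) + inner (G N) (G N) / 2) \<le> u i * (F i - F (Suc i)) + v i * (F N - F i)"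
    if i: "i \<le> M" for i
  proof -
    have "u i * (inner (G (Suc i)) (x i - x (Suc i)) + (norm (G i - G (Suc i)))\<^sup>2 / 2) \<le> u i * (F i - F (Suc i))"
      using coco[of i "Suc i"] i u[OF i] by (intro mult_left_mono) auto
    moreover have "v i * (inner (G i) (x N - x i) + (norm (G N - G i))\<^sup>2 / 2) \<le> v i * (F N - F i)"
      using coco[of N i] i v[OF i] by (intro mult_left_mono) (auto simp: N_def)
    moreover have "inner (G i) (x N - x i) + (norm (G N - G i))\<^sup>2 / 2 =
       (inner (G i) (G i) / 2 - inner (G i) (x i)) + (inner (G i) (x N - G N) + inner (G N) (G N) / 2)"
      by (simp add: power2_norm_eq_inner inner_diff inner_commute field_simps)
    ultimately show ?thesis
      unfolding q_def by (simp add: distrib_left)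
  qed
  then have "(\<Sum>i<Suc M. q i + v i * (inner (G i) (x N - G N) + inner (G N) (G N) / 2))
     \<le> (\<Sum>i<Suc M. u i * (F i - F (Suc i)) + v i * (F N - F i))"
    by (intro sum_mono) auto
  also have "\<dots> = F 0 - F N"
    unfolding FF[OF order_refl] by (simp add: N_def algebra_simps)
  finally have main: "(\<Sum>i<Suc M. q i) + (\<Sum>i<Suc M. v i * inner (G i) (x N - G N)) + (\<Sum>i<Suc M. v i) * (inner (G N) (G N) / 2)
     \<le> F 0 - F N"
    by (simp only: sum.distrib distrib_left sum_distrib_right)
  have W: "(\<Sum>i<Suc M. v i * inner (G i) (x N - G N)) = inner (w N) (x N - G N)"
    by (simp add: w_def N_def inner_add_left inner_sum_left)
  \<comment> \<open>The two conditions in \<open>a_last\<close> cancel the products of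
    \<open>w N\<close> with \<open>x N\<close> and with \<open>G N\<close>. The squared norm of
    \<open>G N\<close> keeps the coefficient \<open>u M / 2 + (u M - 1) / 2\<close>;
    \<open>descent\<close> supplies the missing 1/2.\<close>
  have "x 0 - H (Suc M) = x (Suc M)" using xk[of "Suc M"] a_last by simp
  then have "(\<Sum>i<Suc M. q i) = - inner (w N) (x N) + inner (G N) (w N) + u M / 2 * inner (G N) (G N)"
    using Q[OF order_refl] a_last by (simp add: N_def)
  from main[unfolded this W V[OF order_refl]]
  have "u M * inner (G N) (G N) - inner (G N) (G N) / 2 \<le> F 0 - F N"
    by (simp add: inner_diff_right inner_commute field_simps)
  then show ?thesis using descent by (simp add: N_def power2_norm_eq_inner)
qed

section \<open>The OGM-G coefficients and their identities\<close>

text \<open>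
  In the notation of Kim and Fessler for horizon \<open>M + 1\<close>: \<open>\<theta>\<^sub>k\<close> is \<open>ogm_theta (M + 1 - k)\<close> for \<open>k \<ge> 1\<close>,
  and \<open>\<theta>\<^sub>0\<close> is \<open>ogm_theta_first M\<close>.
\<close>

primrec ogm_theta :: "nat \<Rightarrow> real" where
  "ogm_theta 0 = 1"
| "ogm_theta (Suc m) = (1 + sqrt (1 + 4 * (ogm_theta m)\<^sup>2)) / 2"

definition ogm_theta_first :: "nat \<Rightarrow> real" where
  "ogm_theta_first M = (1 + sqrt (1 + 8 * (ogm_theta M)\<^sup>2)) / 2"

lemma ogm_theta_ge: "(real m + 2) / 2 \<le> ogm_theta m"
proof (induction m)
  case (Suc m)
  have "2 * ogm_theta m \<le> sqrt (1 + 4 * (ogm_theta m)\<^sup>2)"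
    by (rule real_le_rsqrt) (simp add: power_mult_distrib)
  then show ?case using Suc by simp
qed simp

lemma ogm_theta_pos: "0 < ogm_theta m"
  using ogm_theta_ge[of m] by (rule less_le_trans[rotated]) simp

lemma ogm_theta_rec: "ogm_theta (Suc m) * (ogm_theta (Suc m) - 1) = (ogm_theta m)\<^sup>2"
proof -
  have "(sqrt (1 + 4 * (ogm_theta m)\<^sup>2))\<^sup>2 = 1 + 4 * (ogm_theta m)\<^sup>2" by simp
  then show ?thesis by (simp add: field_simps power2_eq_square)
qed

lemma ogm_theta_first_rec:
  "ogm_theta_first M * (ogm_theta_first M - 1) = 2 * (ogm_theta M)\<^sup>2"
proof -
  have "(sqrt (1 + 8 * (ogm_theta M)\<^sup>2))\<^sup>2 = 1 + 8 * (ogm_theta M)\<^sup>2" by simp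
  then show ?thesis by (simp add: ogm_theta_first_def field_simps power2_eq_square)
qed

lemma ogm_theta_first_gt_1: "1 < ogm_theta_first M"
proof -
  have "1 < sqrt (1 + 8 * (ogm_theta M)\<^sup>2)" using ogm_theta_pos[of M] by simp
  then show ?thesis by (simp add: ogm_theta_first_def)
qed

lemma ogm_theta_first_ge: "(real M + 2)\<^sup>2 / 2 \<le> (ogm_theta_first M)\<^sup>2"
proof -
  have "(real M + 2)\<^sup>2 / 4 \<le> (ogm_theta M)\<^sup>2"
    using power_mono[OF ogm_theta_ge[of M], of 2] by (simp add: power_divide)
  moreover have "(ogm_theta_first M)\<^sup>2 = 2 * (ogm_theta M)\<^sup>2 + ogm_theta_first M"
    using ogm_theta_first_rec[of M] by (simp add: power2_eq_square algebra_simps)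
  ultimately show ?thesis using ogm_theta_first_gt_1[of M] by linarith
qed

definition ogm_u :: "nat \<Rightarrow> nat \<Rightarrow> real" where
  "ogm_u M k = (ogm_theta_first M)\<^sup>2 / (2 * (ogm_theta (M - k))\<^sup>2)"

definition ogm_v :: "nat \<Rightarrow> nat \<Rightarrow> real" where
  "ogm_v M k = (case k of 0 \<Rightarrow> ogm_u M 0 - 1 | Suc i \<Rightarrow> ogm_u M k - ogm_u M i)"

definition ogm_h :: "nat \<Rightarrow> nat \<Rightarrow> real" where
  "ogm_h M k = (case k of 0 \<Rightarrow> (ogm_theta_first M + 1) / 2 | Suc i \<Rightarrow> ogm_theta (M - i))"

text \<open>The value 0 beyond \<open>M\<close> leaves only the weights \<open>h\<close> in the last
  point of the run.\<close>

definition ogm_a :: "nat \<Rightarrow> nat \<Rightarrow> real" where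
  "ogm_a M k = (if k \<le> M then 2 * (ogm_theta (M - k)) ^ 4 / (ogm_theta_first M)\<^sup>2 else 0)"

text \<open>Coefficients relative to the starting point, as in \<open>iterate\<close>, not
  increments between successive points.\<close>

definition ogm_coeff :: "nat \<Rightarrow> nat \<Rightarrow> nat \<Rightarrow> real" where
  "ogm_coeff M j k = ogm_h M j - ogm_a M k * ogm_v M j"

text \<open>The recurrence \<open>2 * t\<^sup>2 = s * (s - 1)\<close> turns all four sequences at
  index 0 into rational functions of \<open>s\<close>.\<close>

lemma ogm_first_identities:
  shows "ogm_h M 0 * ogm_v M 0 = ogm_u M 0 - 1/2" "ogm_v M 0 * ogm_a M 0 = ogm_h M 0 - 1" "0 \<le> ogm_v M 0"
proof -
  define s where "s = ogm_theta_first M"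
  define t where "t = ogm_theta M"
  have s: "1 < s" and t: "2 * t\<^sup>2 = s * (s - 1)"
    using ogm_theta_first_gt_1 ogm_theta_first_rec by (simp_all add: s_def t_def)
  have u: "ogm_u M 0 = s / (s - 1)"
    using s by (simp add: ogm_u_def s_def[symmetric] t_def[symmetric] t) (simp add: power2_eq_square)
  have v: "ogm_v M 0 = 1 / (s - 1)"
    using s by (simp add: ogm_v_def u field_simps)
  have "4 * t ^ 4 = (2 * t\<^sup>2)\<^sup>2" by (simp add: power_mult_distrib flip: power_mult)
  then have "4 * t ^ 4 = s\<^sup>2 * (s - 1)\<^sup>2" by (simp add: t power_mult_distrib)
  then have a: "ogm_a M 0 = (s - 1)\<^sup>2 / 2"
    using s by (simp add: ogm_a_def s_def[symmetric] t_def[symmetric] field_simps)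
  have h: "ogm_h M 0 = (s + 1) / 2" by (simp add: ogm_h_def s_def)
  show "ogm_h M 0 * ogm_v M 0 = ogm_u M 0 - 1/2" using s by (simp add: u v h field_simps)
  show "ogm_v M 0 * ogm_a M 0 = ogm_h M 0 - 1" using s by (simp add: v a h field_simps power2_eq_square)
  show "0 \<le> ogm_v M 0" using s by (simp add: v)
qed

text \<open>With \<open>t\<^sup>2 = T * (T - 1)\<close> everything is rational in \<open>T\<close>;
  the factor \<open>c\<close> of \<open>u\<close> and \<open>v\<close> cancels against
  \<open>1 / c\<close> in \<open>a\<close>.\<close>

lemma ogm_Suc_identities:
  assumes "k < M"
  shows "ogm_h M (Suc k) * ogm_v M (Suc k) = ogm_u M (Suc k)"
    "ogm_v M (Suc k) * ogm_a M (Suc k) = ogm_h M (Suc k) - 1"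
    "ogm_u M k * (ogm_a M k - ogm_a M (Suc k)) = 2 * ogm_h M (Suc k) - 1"
    "0 \<le> ogm_v M (Suc k)"
proof -
  define m where "m = M - Suc k"
  have m: "M - k = Suc m" "M - Suc k = m" using assms by (auto simp: m_def)
  define c where "c = (ogm_theta_first M)\<^sup>2 / 2"
  define T where "T = ogm_theta (Suc m)"
  define t where "t = ogm_theta m"
  have c: "0 < c" using ogm_theta_first_gt_1[of M] by (simp add: c_def)
  have T: "1 < T" unfolding T_def using ogm_theta_ge[of "Suc m"] by (rule less_le_trans[rotated]) simp
  have t: "t\<^sup>2 = T * (T - 1)" using ogm_theta_rec by (simp add: T_def t_def)
  have "t ^ 4 = (t\<^sup>2)\<^sup>2" by (simp flip: power_mult)
  then have t4: "t ^ 4 = T\<^sup>2 * (T - 1)\<^sup>2" by (simp add: t power_mult_distrib)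
  have u: "ogm_u M k = c / T\<^sup>2" "ogm_u M (Suc k) = c / (T * (T - 1))"
    unfolding ogm_u_def m t_def[symmetric] T_def[symmetric] t c_def by simp_all
  have v: "ogm_v M (Suc k) = c / (T\<^sup>2 * (T - 1))"
    using T by (simp add: ogm_v_def u field_simps power2_eq_square)
  have h: "ogm_h M (Suc k) = T" by (simp add: ogm_h_def m T_def)
  have a: "ogm_a M k = T ^ 4 / c" "ogm_a M (Suc k) = T\<^sup>2 * (T - 1)\<^sup>2 / c"
    unfolding ogm_a_def m t_def[symmetric] T_def[symmetric] t4 c_def using assms by simp_all
  show "ogm_h M (Suc k) * ogm_v M (Suc k) = ogm_u M (Suc k)"
    using T by (simp add: h v u power2_eq_square)
  show "ogm_v M (Suc k) * ogm_a M (Suc k) = ogm_h M (Suc k) - 1"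
    using T c by (simp add: h v a power2_eq_square)
  show "ogm_u M k * (ogm_a M k - ogm_a M (Suc k)) = 2 * ogm_h M (Suc k) - 1"
    using T c by (simp add: h u a field_simps power2_eq_square power4_eq_xxxx)
  show "0 \<le> ogm_v M (Suc k)" using T c by (simp add: v)
qed

section \<open>The rate for a fixed horizon\<close>

lemma ogm_gradient_bound:
  fixes x G :: "nat \<Rightarrow> 'a::real_inner" and F :: "nat \<Rightarrow> real"
  assumes coco: "\<And>i j. i \<le> Suc M \<Longrightarrow> j \<le> Suc M \<Longrightarrow>
      F j + inner (G j) (x i - x j) + (norm (G i - G j))\<^sup>2 / 2 \<le> F i"
    and descent: "Fs + (norm (G (Suc M)))\<^sup>2 / 2 \<le> F (Suc M)"
    and x: "\<And>k. k \<le> Suc M \<Longrightarrow> x k = x 0 - (\<Sum>j<k. ogm_coeff M j k *\<^sub>R G j)"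
  shows "(real M + 2)\<^sup>2 / 4 * (norm (G (Suc M)))\<^sup>2 \<le> F 0 - Fs"
proof -
  have "ogm_u M M * (norm (G (Suc M)))\<^sup>2 \<le> F 0 - Fs"
  proof (rule gradient_certificate[where u = "ogm_u M" and v = "ogm_v M" and h = "ogm_h M" and a = "ogm_a M"
        and x = x, OF coco descent])
    show "x k = x 0 - (\<Sum>j<k. (ogm_h M j - ogm_a M k * ogm_v M j) *\<^sub>R G j)" if "k \<le> Suc M" for k
      using x[OF that] by (simp add: ogm_coeff_def)
    show "0 \<le> ogm_u M k" for k by (simp add: ogm_u_def)
    show "0 \<le> ogm_v M k" "ogm_v M k * ogm_a M k = ogm_h M k - 1" if "k \<le> M" for k
      using that by (cases k; simp add: ogm_first_identities ogm_Suc_identities)+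
    show "ogm_u M M * ogm_a M M = 1"
      using ogm_theta_first_gt_1[of M] by (simp add: ogm_u_def ogm_a_def)
    show "ogm_v M 0 = ogm_u M 0 - 1" "ogm_v M (Suc k) = ogm_u M (Suc k) - ogm_u M k" for k
      by (simp_all add: ogm_v_def)
    show "ogm_a M (Suc M) = 0" by (simp add: ogm_a_def)
  qed (simp_all add: ogm_first_identities ogm_Suc_identities)
  \<comment> \<open>Since \<open>ogm_theta 0 = 1\<close>, the multiplier \<open>ogm_u M M\<close> is
    half the square of \<open>ogm_theta_first M\<close>.\<close>
  moreover have "(real M + 2)\<^sup>2 / 4 \<le> ogm_u M M"
    using ogm_theta_first_ge[of M] by (simp add: ogm_u_def)
  then have "(real M + 2)\<^sup>2 / 4 * (norm (G (Suc M)))\<^sup>2 \<le> ogm_u M M * (norm (G (Suc M)))\<^sup>2"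
    by (rule mult_right_mono) simp
  ultimately show ?thesis by linarith
qed

text \<open>Any sequence obeying the recursion is allowed, so that a run embedded in a longer method
  qualifies.\<close>

lemma ogm_gradient_rate:
  assumes L: "L > 0" and f: "smooth_convex L d f"
    and y: "\<And>k. k \<le> Suc M \<Longrightarrow> y k \<in> Rd d"
    and step: "\<And>k. k \<le> Suc M \<Longrightarrow> y k = y 0 - (1 / L) *\<^sub>R (\<Sum>j<k. ogm_coeff M j k *\<^sub>R grad d f (y j))"
  shows "(norm (grad d f (y (Suc M))))\<^sup>2 \<le> 4 / (real M + 2)\<^sup>2 * (L * (f (y 0) - fstar d f))"
proof -
  define G where "G k = (1 / L) *\<^sub>R grad d f (y k)" for k
  have nG: "(norm (G k))\<^sup>2 = (norm (grad d f (y k)))\<^sup>2 / L\<^sup>2" for k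
    using L by (simp add: G_def power_divide)
  have nGd: "(norm (G i - G j))\<^sup>2 = (norm (grad d f (y i) - grad d f (y j)))\<^sup>2 / L\<^sup>2" for i j
    using L by (simp add: G_def power_divide flip: scaleR_diff_right)
  have "(real M + 2)\<^sup>2 / 4 * (norm (G (Suc M)))\<^sup>2 \<le> f (y 0) / L - fstar d f / L"
  proof (rule ogm_gradient_bound[where x = y])
    fix i j assume ij: "i \<le> Suc M" "j \<le> Suc M"
    have "(f (y j) + inner (grad d f (y j)) (y i - y j) +
        (norm (grad d f (y i) - grad d f (y j)))\<^sup>2 / (2 * L)) / L \<le> f (y i) / L"
      using smooth_convex_cocoercive[OF L f y[OF ij(1)] y[OF ij(2)]] L by (intro divide_right_mono) auto
    then show "f (y j) / L + inner (G j) (y i - y j) + (norm (G i - G j))\<^sup>2 / 2 \<le> f (y i) / L"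
      unfolding nGd by (simp add: G_def add_divide_distrib power2_eq_square ac_simps)
  next
    have "(fstar d f + (norm (grad d f (y (Suc M))))\<^sup>2 / (2 * L)) / L \<le> f (y (Suc M)) / L"
      using smooth_convex_gradient_step[OF L f y[OF order_refl]] L by (intro divide_right_mono) auto
    then show "fstar d f / L + (norm (G (Suc M)))\<^sup>2 / 2 \<le> f (y (Suc M)) / L"
      unfolding nG by (simp add: add_divide_distrib power2_eq_square ac_simps)
  next
    show "y k = y 0 - (\<Sum>j<k. ogm_coeff M j k *\<^sub>R G j)" if "k \<le> Suc M" for k
      using step[OF that] by (simp add: G_def scaleR_sum_right mult.commute)
  qed
  then have "(real M + 2)\<^sup>2 / 4 * (norm (grad d f (y (Suc M))))\<^sup>2 \<le> L * (f (y 0) - fstar d f)"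
    unfolding nG using L
    by (simp add: pos_le_divide_eq pos_divide_le_eq power2_eq_square mult.commute flip: diff_divide_distrib)
  moreover have "0 < (real M + 2)\<^sup>2" by simp
  ultimately show ?thesis by (simp add: field_simps)
qed

section \<open>The restarted method\<close>

lemma iterate_in_Rd:
  assumes f: "smooth_convex L d f" and x0: "x0 \<in> Rd d"
  shows "iterate L \<beta> d f x0 k \<in> Rd d"
proof (induction k rule: less_induct)
  case (less k)
  then have "(\<Sum>i<k. \<beta> i k *\<^sub>R grad d f (iterate L \<beta> d f x0 i)) \<in> Rd d"
    by (intro subspace_sum subspace_scale subspace_Rd smooth_convex_has_derivative(1)[OF f]) auto
  then show ?case
    by (subst iterate.simps) (intro subspace_diff subspace_scale subspace_Rd x0)
qed

text \<open>
  With \<open>n = 2 ^ floor_log k\<close>, index \<open>k\<close> is step \<open>k + 1 - n\<close> of the run with horizon \<open>n\<close>; step \<open>0\<close> of every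
  run is index \<open>0\<close>.
\<close>

definition restart_coeff :: "nat \<Rightarrow> nat \<Rightarrow> real" where
  "restart_coeff i k = (let n = 2 ^ floor_log k in
     if i = 0 then ogm_coeff (n - 1) 0 (Suc k - n)
     else if n \<le> i then ogm_coeff (n - 1) (Suc i - n) (Suc k - n) else 0)"

text \<open>\<open>e\<close> sends the steps of one run to global indices. The indices from 1 to
  \<open>n - 1\<close> belong to earlier runs and get coefficient 0, so the run sees only its own
  gradients and the one at \<open>x0\<close>.\<close>

lemma restart_block:
  fixes J L d f x0
  defines "n \<equiv> (2::nat) ^ J" and "X \<equiv> iterate L restart_coeff d f x0"
  defines "e \<equiv> \<lambda>l. if l = 0 then 0 else n - 1 + l"
  assumes l: "l \<le> n"
  shows "X (e l) = X (e 0) - (1 / L) *\<^sub>R (\<Sum>m<l. ogm_coeff (n - 1) m l *\<^sub>R grad d f (X (e m)))"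
proof (cases "l = 0")
  case False
  define k where "k = n - 1 + l"
  have n: "1 \<le> n" by (simp add: n_def)
  have k: "n \<le> k" "k < 2 * n" "Suc k - n = l" "e l = k" using l n False by (auto simp: k_def e_def)
  have fl: "2 ^ floor_log k = n"
    unfolding n_def using k floor_log_eqI[of k J] n by (simp add: n_def)
  have "(\<Sum>i<k. restart_coeff i k *\<^sub>R grad d f (X i)) = (\<Sum>i\<in>e ` {..<l}. restart_coeff i k *\<^sub>R grad d f (X i))"
  proof (rule sum.mono_neutral_right)
    show "e ` {..<l} \<subseteq> {..<k}" using False n by (auto simp: e_def k_def)
    show "\<forall>i\<in>{..<k} - e ` {..<l}. restart_coeff i k *\<^sub>R grad d f (X i) = 0"
    proof
      fix i assume i: "i \<in> {..<k} - e ` {..<l}"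
      have "i \<noteq> 0" using i False by (force simp: e_def)
      moreover have "\<not> n \<le> i"
      proof
        assume "n \<le> i"
        then have "i = e (Suc i - n)" "Suc i - n < l" using n i by (auto simp: e_def k_def)
        then show False using i by blast
      qed
      ultimately show "restart_coeff i k *\<^sub>R grad d f (X i) = 0"
        by (simp add: restart_coeff_def fl)
    qed
  qed simp
  also have "\<dots> = (\<Sum>m<l. restart_coeff (e m) k *\<^sub>R grad d f (X (e m)))"
    by (subst sum.reindex) (use n in \<open>auto simp: inj_on_def e_def split: if_splits\<close>)
  also have "\<dots> = (\<Sum>m<l. ogm_coeff (n - 1) m l *\<^sub>R grad d f (X (e m)))"
    by (rule sum.cong) (use n k(3) in \<open>auto simp: restart_coeff_def fl e_def\<close>)
  finally have "X k = X 0 - (1 / L) *\<^sub>R (\<Sum>m<l. ogm_coeff (n - 1) m l *\<^sub>R grad d f (X (e m)))"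
    unfolding X_def by (subst iterate.simps) (simp add: iterate_0)
  moreover have "e 0 = 0" by (simp add: e_def)
  ultimately show ?thesis by (simp only: k)
qed simp

text \<open>The index is \<open>e n = (n - 1) + n\<close> for \<open>n = 2 ^ J\<close>, the last
  step of the run with horizon \<open>n\<close>.\<close>

lemma rate_last_restart:
  assumes L: "L > 0"
  shows "rate_last L restart_coeff (2 ^ Suc J - 1) \<le> ereal (4 / (2 ^ J + 1)\<^sup>2)"
  unfolding rate_last_def
proof (rule Sup_least, clarsimp)
  fix d f x0
  assume f: "smooth_convex L d f" and x0: "x0 \<in> Rd d" and gap: "fstar d f < f x0"
  define n where "n = (2::nat) ^ J"
  define X where "X = iterate L restart_coeff d f x0"
  define e where "e l = (if l = 0 then 0 else n - 1 + l)" for l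
  have n: "1 \<le> n" by (simp add: n_def)
  then have Sn: "Suc (n - 1) = n" by simp
  have "(norm (grad d f (X (e (Suc (n - 1))))))\<^sup>2 \<le> 4 / (real (n - 1) + 2)\<^sup>2 * (L * (f (X (e 0)) - fstar d f))"
  proof (rule ogm_gradient_rate[OF L f])
    show "X (e k) \<in> Rd d" for k unfolding X_def by (rule iterate_in_Rd[OF f x0])
    show "X (e k) = X (e 0) - (1 / L) *\<^sub>R (\<Sum>j<k. ogm_coeff (n - 1) j k *\<^sub>R grad d f (X (e j)))"
      if "k \<le> Suc (n - 1)" for k
      using restart_block[of k J L d f x0] that Sn unfolding X_def e_def n_def by simp
  qed
  moreover have "e (Suc (n - 1)) = 2 ^ Suc J - 1" using n by (simp add: e_def n_def)
  moreover have "X (e 0) = x0" by (simp add: e_def X_def iterate_0)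
  moreover have "real (n - 1) + 2 = 2 ^ J + 1"
  proof -
    have "real n = 2 ^ J" by (simp add: n_def)
    then show ?thesis using n by (simp add: of_nat_diff)
  qed
  ultimately have "(norm (grad d f (X (2 ^ Suc J - 1))))\<^sup>2 \<le> 4 / (2 ^ J + 1)\<^sup>2 * (L * (f x0 - fstar d f))"
    by (simp only:)
  then show "(norm (grad d f (iterate L restart_coeff d f x0 (2 * 2 ^ J - Suc 0))))\<^sup>2 / (L * (f x0 - fstar d f))
      \<le> 4 / (2 ^ J + 1)\<^sup>2"
    using L gap by (simp add: X_def divide_le_eq)
qed

section \<open>Selector and final bound\<close>

lemma rate_best_le_rate_last:
  assumes L: "L > 0" and "n \<le> N"
  shows "rate_best L \<beta> N \<le> rate_last L \<beta> n"
  unfolding rate_best_def rate_last_def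
proof (rule Sup_mono, clarify)
  fix d f x0
  assume *: "1 \<le> d" "smooth_convex L d f" "x0 \<in> Rd d" "fstar d f < f x0"
  let ?g = "\<lambda>k. (norm (grad d f (iterate L \<beta> d f x0 k)))\<^sup>2"
  have "(MIN k\<in>{..N}. ?g k) / (L * (f x0 - fstar d f)) \<le> ?g n / (L * (f x0 - fstar d f))"
    using assms * by (intro divide_right_mono Min_le) auto
  with * show "\<exists>r\<in>{ereal ((norm (grad d f (iterate L \<beta> d f x0 n)))\<^sup>2 / (L * (f x0 - fstar d f))) | d f x0.
        d \<ge> 1 \<and> smooth_convex L d f \<and> x0 \<in> Rd d \<and> f x0 > fstar d f}.
      ereal ((MIN k\<in>{..N}. ?g k) / (L * (f x0 - fstar d f))) \<le> r"
    by (intro bexI[of _ "ereal (?g n / (L * (f x0 - fstar d f)))"]) auto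
qed

theorem proposition7:
  fixes L :: real
  assumes "L > 0"
  shows "\<exists>(\<beta> :: nat \<Rightarrow> nat \<Rightarrow> real) (p :: nat \<Rightarrow> nat).
           (\<forall>N\<ge>1. p N \<le> N) \<and>
           (\<forall>N\<ge>1. rate_best L \<beta> N \<le> rate_last L \<beta> (p N) \<and>
                  rate_last L \<beta> (p N) \<le> ereal (64 / (real N + 1)\<^sup>2))"
proof (intro exI conjI allI impI)
  fix N :: nat assume N: "1 \<le> N"
  \<comment> \<open>The largest index of the form \<open>2 ^ i - 1\<close> up to \<open>N\<close>,
    where the last completed run ends.\<close>
  let ?p = "\<lambda>N. 2 ^ floor_log (Suc N) - 1 :: nat"
  show p: "?p N \<le> N"
    using floor_log_exp2_le[of "Suc N"] by simp
  show "rate_best L restart_coeff N \<le> rate_last L restart_coeff (?p N)"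
    by (rule rate_best_le_rate_last[OF assms p])
  obtain J where J: "floor_log (Suc N) = Suc J"
    by (rule that[OF floor_log_rec]) (use N in simp)
  have "Suc N < 4 * 2 ^ J"
    using floor_log_exp2_gt[of "Suc N"] by (simp add: J)
  then have "real (Suc N) < real (4 * 2 ^ J)" by (simp only: of_nat_less_iff)
  \<comment> \<open>The constant 64 is the 4 of the fixed-horizon rate times the square of this
    factor 4.\<close>
  then have "(real N + 1)\<^sup>2 \<le> (4 * (2 ^ J + 1))\<^sup>2"
    by (intro power_mono) auto
  then have "64 / (4 * (2 ^ J + 1))\<^sup>2 \<le> 64 / (real N + 1)\<^sup>2"
    by (intro divide_left_mono mult_pos_pos zero_less_power) (auto simp: add_pos_pos)
  moreover have "64 / (4 * (2 ^ J + 1))\<^sup>2 = 4 / (2 ^ J + 1 :: real)\<^sup>2"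
    unfolding power_mult_distrib by simp
  ultimately have "4 / (2 ^ J + 1)\<^sup>2 \<le> 64 / (real N + 1)\<^sup>2" by simp
  then show "rate_last L restart_coeff (?p N) \<le> ereal (64 / (real N + 1)\<^sup>2)"
    using rate_last_restart[OF assms, of J] unfolding J by (meson ereal_less_eq(3) order_trans)
qed

end
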